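(* Let $B$ be an $n$-by-$n$ partial reciprocal matrix (PRM) whose graph $G(B)$ of specified entries is chordal. Then $B$ has a reciprocal completion $\widetilde{B}$ such that $MT(\widetilde{B})=MT(B)$.
   Context: A PRM is an $n$-by-$n$ partial matrix whose diagonal entries are specified and equal to $1$, whose pattern of specified entries is symmetric, and such that whenever the $(i,j)$ entry is specified it is positive and the $(j,i)$ entry is specified and equal to its reciprocal. Its graph $G(B)$ is the undirected graph on $\{1,\ldots,n\}$ with edge $\{i,j\}$ ($i\ne j$) iff the $(i,j)$ entry is specified; $G(B)$ is chordal if every cycle on $4$ or more vertices has a chord. A reciprocal completion is an entrywise positive matrix $[b_{ij}]$ with $b_{ji}=1/b_{ij}$ agreeing with $B$ on all specified entries. For a partial (or full) reciprocal matrix $M=[m_{ij}]$, $MT(M)$ is the maximum of the $3$-cycle products $m_{ij}m_{jk}m_{ki}$ over all triples of distinct indices $i,j,k$ for which $m_{ij},m_{jk},m_{ki}$ are all specified; if there is no such triple, $MT(M)=1$. *)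

theory Defs
  imports "HOL-Analysis.Analysis"
begin

text \<open>
  An n-by-n partial matrix is a matrix with entries in \<open>real option\<close>: \<open>None\<close> marks an
  unspecified entry. The index set \<open>{1,...,n}\<close> is an arbitrary finite type \<open>'n\<close>.
\<close>

type_synonym 'n partial_matrix = "real option ^ 'n ^ 'n"

definition partial_reciprocal_matrix :: "'n::finite partial_matrix \<Rightarrow> bool" where
  "partial_reciprocal_matrix B \<longleftrightarrow>
     (\<forall>i. B $ i $ i = Some 1) \<and>
     (\<forall>i j x. B $ i $ j = Some x \<longrightarrow> 0 < x \<and> B $ j $ i = Some (1 / x))"

text \<open>Undirected simple graphs are represented by their set of two-element edges.\<close>

definition spec_graph :: "'n::finite partial_matrix \<Rightarrow> 'n set set" where
  "spec_graph B = {{i, j} | i j. i \<noteq> j \<and> B $ i $ j \<noteq> None}"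

text \<open>
  A cycle is given by the list of its vertices in cyclic order, without repeating the first
  one at the end.
\<close>

definition cycle_edges :: "'a list \<Rightarrow> 'a set set" where
  "cycle_edges vs = {{vs ! k, vs ! (Suc k mod length vs)} | k. k < length vs}"

definition graph_cycle :: "'a set set \<Rightarrow> 'a list \<Rightarrow> bool" where
  "graph_cycle E vs \<longleftrightarrow> 3 \<le> length vs \<and> distinct vs \<and> cycle_edges vs \<subseteq> E"

definition has_chord :: "'a set set \<Rightarrow> 'a list \<Rightarrow> bool" where
  "has_chord E vs \<longleftrightarrow>
     (\<exists>u\<in>set vs. \<exists>v\<in>set vs. u \<noteq> v \<and> {u, v} \<in> E \<and> {u, v} \<notin> cycle_edges vs)"

definition chordal :: "'a set set \<Rightarrow> bool" where
  "chordal E \<longleftrightarrow> (\<forall>vs. graph_cycle E vs \<and> 4 \<le> length vs \<longrightarrow> has_chord E vs)"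

definition reciprocal_matrix :: "real ^ 'n ^ 'n::finite \<Rightarrow> bool" where
  "reciprocal_matrix A \<longleftrightarrow> (\<forall>i j. 0 < A $ i $ j \<and> A $ j $ i = 1 / A $ i $ j)"

definition reciprocal_completion :: "'n::finite partial_matrix \<Rightarrow> real ^ 'n ^ 'n \<Rightarrow> bool" where
  "reciprocal_completion B A \<longleftrightarrow>
     reciprocal_matrix A \<and> (\<forall>i j x. B $ i $ j = Some x \<longrightarrow> A $ i $ j = x)"

definition fully_specified :: "real ^ 'n ^ 'n::finite \<Rightarrow> 'n partial_matrix" where
  "fully_specified A = (\<chi> i j. Some (A $ i $ j))"

definition three_cycle_products :: "'n::finite partial_matrix \<Rightarrow> real set" where
  "three_cycle_products B =
     {x * y * z | x y z. \<exists>i j k. i \<noteq> j \<and> j \<noteq> k \<and> k \<noteq> i \<and>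
        B $ i $ j = Some x \<and> B $ j $ k = Some y \<and> B $ k $ i = Some z}"

definition MT :: "'n::finite partial_matrix \<Rightarrow> real" where
  "MT B = (if three_cycle_products B = {} then 1 else Max (three_cycle_products B))"

text \<open>There are finitely many index triples, so \<^const>\<open>Max\<close> in \<^const>\<open>MT\<close> is a genuine maximum.\<close>

lemma finite_three_cycle_products: "finite (three_cycle_products B)"
proof (rule finite_subset)
  let ?f = "\<lambda>(i, j, k). the (B $ i $ j) * the (B $ j $ k) * the (B $ k $ i)"
  show "three_cycle_products B \<subseteq> range ?f"
  proof
    fix p assume "p \<in> three_cycle_products B"
    then obtain x y z i j k where "p = x * y * z"
      "B $ i $ j = Some x" "B $ j $ k = Some y" "B $ k $ i = Some z"
      unfolding three_cycle_products_def by blast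
    then have "p = ?f (i, j, k)" by simp
    then show "p \<in> range ?f" by blast
  qed
qed simp

end

theory Submission
  imports Defs
begin

text \<open>
  Passing to logarithms, \<open>B\<close> becomes an antisymmetric function on the edges of a chordal graph
  whose sums over oriented triangles are at most \<open>M = ln (MT B)\<close>. Remove a simplicial vertex \<open>s\<close>
  and complete the rest inductively to \<open>g\<close>. If \<open>K\<close> is the clique of neighbours of \<open>s\<close>, then
  \<open>x w = max {f s k + g k w | k \<in> K} - M\<close> is an admissible entry at \<open>(s, w)\<close> for every
  non-neighbour \<open>w\<close>, in the manner of McShane's extension of Lipschitz functions. Reversing a
  triangle inverts its product, so \<open>MT\<close> is at least 1 and its value is preserved even when
  \<open>B\<close> has no specified triangle.
\<close>

section \<open>Simplicial vertices of chordal graphs\<close>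

text \<open>With \<open>m\<close> the least length of a walk, splicing the initial segment up to
  \<open>w i\<close> with the final segment from \<open>w j\<close> would give a shorter walk if a
  vertex were repeated or a forward shortcut existed.\<close>

lemma shortest_walk:
  assumes "(x, y) \<in> T\<^sup>*"
  obtains w :: "nat \<Rightarrow> 'a" and m where "w 0 = x" "w m = y" "inj_on w {..m}"
    "\<And>i. i < m \<Longrightarrow> (w i, w (Suc i)) \<in> T"
    "\<And>i j. i < j \<Longrightarrow> j \<le> m \<Longrightarrow> (w i, w j) \<in> T \<Longrightarrow> j = Suc i"
proof -
  define m where "m = (LEAST n. (x, y) \<in> T ^^ n)"
  have m: "(x, y) \<in> T ^^ m"
    unfolding m_def using assms by (metis LeastI rtrancl_imp_relpow)
  have least: "m \<le> n" if "(x, y) \<in> T ^^ n" for n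
    unfolding m_def using that by (rule Least_le)
  obtain w where w: "w 0 = x" "w m = y" "\<And>i. i < m \<Longrightarrow> (w i, w (Suc i)) \<in> T"
    using m unfolding relpow_fun_conv by blast
  have seg: "(w i, w (i + d)) \<in> T ^^ d" if "i + d \<le> m" for i d
    unfolding relpow_fun_conv using that w(3) by (intro exI[of _ "\<lambda>k. w (i + k)"]) auto
  have init: "(x, w i) \<in> T ^^ i" if "i \<le> m" for i
    using seg[of 0 i] that w(1) by simp
  have final: "(w j, y) \<in> T ^^ (m - j)" if "j \<le> m" for j
    using seg[of j "m - j"] that w(2) by simp
  have chord: "j = Suc i" if "i < j" "j \<le> m" "(w i, w j) \<in> T" for i j
  proof -
    have "(x, w j) \<in> T ^^ Suc i"
      using init[of i] that by auto
    with final[OF that(2)] have "(x, y) \<in> T ^^ (Suc i + (m - j))"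
      unfolding relpow_add by blast
    with least[of "Suc i + (m - j)"] that show ?thesis by simp
  qed
  have "w i \<noteq> w j" if "i < j" "j \<le> m" for i j
  proof
    assume "w i = w j"
    then have "(x, y) \<in> T ^^ (i + (m - j))"
      using init[of i] final[of j] that unfolding relpow_add by auto
    with least[of "i + (m - j)"] that show False by simp
  qed
  then have "inj_on w {..m}"
    by (metis atMost_iff inj_onI nat_neq_iff)
  with w chord that show thesis by blast
qed

text \<open>If \<open>x\<close> and \<open>y\<close> were not adjacent, a shortest walk between them
  would have at least two edges and close up through \<open>v\<close> to a cycle of length at least
  4. Minimality excludes chords between walk vertices, and no vertex of \<open>C\<close> sees
  \<open>v\<close>.\<close>

lemma chordal_neighbours_adjacent:
  assumes "chordal E"
    and v: "v \<notin> C" "\<And>c. c \<in> C \<Longrightarrow> {c, v} \<notin> E"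
    and x: "x \<noteq> v" "{x, v} \<in> E" and y: "y \<noteq> v" "{y, v} \<in> E" and "x \<noteq> y"
    and walk: "(x, y) \<in> {(a, b). a \<in> insert x (insert y C) \<and> b \<in> insert x (insert y C) \<and>
      a \<noteq> b \<and> {a, b} \<in> E}\<^sup>*" (is "_ \<in> ?T\<^sup>*")
  shows "{x, y} \<in> E"
proof (rule ccontr)
  assume nonadj: "{x, y} \<notin> E"
  obtain w m where w: "w 0 = x" "w m = y" "inj_on w {..m}"
    and step: "\<And>i. i < m \<Longrightarrow> (w i, w (Suc i)) \<in> ?T"
    and chord: "\<And>i j. i < j \<Longrightarrow> j \<le> m \<Longrightarrow> (w i, w j) \<in> ?T \<Longrightarrow> j = Suc i"
    using shortest_walk[OF walk] by blast
  have "m \<noteq> 0" using w \<open>x \<noteq> y\<close> by metis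
  moreover have "m \<noteq> 1" using w step[of 0] nonadj by auto
  ultimately have m: "2 \<le> m" by simp
  have in_set: "w i \<in> insert x (insert y C)" if "i \<le> m" for i
    using that step[of i] w(2) by (cases "i = m") auto
  \<comment> \<open>Since \<open>v\<close> has index 0, \<open>w i\<close> has index
    \<open>Suc i\<close>, and the last index \<open>Suc m\<close> wraps around to
    \<open>v\<close>.\<close>
  define vs where "vs = v # map w [0..<Suc m]"
  have len: "length vs = m + 2" by (simp add: vs_def)
  have nth_Suc: "vs ! Suc i = w i" if "i \<le> m" for i
    using that unfolding vs_def by (simp del: upt_Suc)
  have nth_0: "vs ! 0 = v" by (simp add: vs_def)
  have set_vs: "set vs = insert v (w ` {..m})"
    unfolding vs_def by (simp add: atLeast0LessThan lessThan_Suc_atMost del: upt_Suc)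
  have w_neq: "w i \<noteq> v" if "i \<le> m" for i
    using in_set[OF that] v x y by auto
  have dist: "distinct vs"
    using w_neq w(3) unfolding vs_def
    by (auto simp: distinct_map atLeast0LessThan lessThan_Suc_atMost simp del: upt_Suc)
  have cyc: "cycle_edges vs = {{v, x}, {y, v}} \<union> {{w i, w (Suc i)} | i. i < m}" (is "_ = ?R")
  proof
    show "cycle_edges vs \<subseteq> ?R"
    proof
      fix e assume "e \<in> cycle_edges vs"
      then obtain k where k: "k < m + 2" "e = {vs ! k, vs ! (Suc k mod (m + 2))}"
        unfolding cycle_edges_def len by blast
      consider "k = 0" | i where "k = Suc i" "i < m" | "k = Suc m"
        using k(1) by (cases k) (auto simp: less_Suc_eq)
      then show "e \<in> ?R"
      proof cases
        case 1
        then show ?thesis using k nth_0 nth_Suc[of 0] w by simp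
      next
        case (2 i)
        then show ?thesis using k nth_Suc[of i] nth_Suc[of "Suc i"] by auto
      next
        case 3
        then show ?thesis using k nth_0 nth_Suc[of m] w by simp
      qed
    qed
    have edge: "{vs ! k, vs ! (Suc k mod (m + 2))} \<in> cycle_edges vs" if "k < m + 2" for k
      using that unfolding cycle_edges_def len by blast
    have "{w i, w (Suc i)} \<in> cycle_edges vs" if "i < m" for i
      using edge[of "Suc i"] nth_Suc[of i] nth_Suc[of "Suc i"] that by simp
    moreover have "{v, x} \<in> cycle_edges vs" "{y, v} \<in> cycle_edges vs"
      using edge[of 0] edge[of "Suc m"] nth_0 nth_Suc[of 0] nth_Suc[of m] w by simp_all
    ultimately show "?R \<subseteq> cycle_edges vs" by blast
  qed
  have "cycle_edges vs \<subseteq> E"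
    using step x y unfolding cyc by (auto simp: insert_commute)
  then have "has_chord E vs"
    using \<open>chordal E\<close> m dist len unfolding chordal_def graph_cycle_def by auto
  then obtain a b where ab: "a \<in> set vs" "b \<in> set vs" "a \<noteq> b" "{a, b} \<in> E" "{a, b} \<notin> cycle_edges vs"
    unfolding has_chord_def by blast
  \<comment> \<open>A walk vertex adjacent to \<open>v\<close> is outside \<open>C\<close>, hence
    \<open>x\<close> or \<open>y\<close>, whose edges to \<open>v\<close> already belong to the
    cycle.\<close>
  have no_v: "{v, w i} \<in> cycle_edges vs" if "i \<le> m" "{v, w i} \<in> E" for i
    using in_set[OF that(1)] that(2) v(2)[of "w i"] unfolding cyc by (auto simp: insert_commute)
  have no_w: "{w i, w j} \<in> cycle_edges vs" if "i < j" "j \<le> m" "w i \<noteq> w j" "{w i, w j} \<in> E" for i j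
  proof -
    have "j = Suc i" using that in_set[of i] in_set[of j] by (intro chord) auto
    with that show ?thesis unfolding cyc by auto
  qed
  show False
  proof (cases "a = v \<or> b = v")
    case True
    with ab set_vs no_v show False by (auto simp: insert_commute)
  next
    case False
    then obtain i j where "a = w i" "b = w j" "i \<le> m" "j \<le> m"
      using ab set_vs by auto
    with ab no_w[of i j] no_w[of j i] show False
      by (cases i j rule: linorder_cases) (auto simp: insert_commute)
  qed
qed

text \<open>Relative to \<open>V\<close>, so that inductions shrink the vertex set while
  \<open>E\<close> and its chordality stay fixed.\<close>

definition simplicial :: "'a set set \<Rightarrow> 'a set \<Rightarrow> 'a \<Rightarrow> bool" where
  "simplicial E V s \<longleftrightarrow>
     (\<forall>a\<in>V - {s}. \<forall>b\<in>V - {s}. {s, a} \<in> E \<and> {s, b} \<in> E \<and> a \<noteq> b \<longrightarrow> {a, b} \<in> E)"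

text \<open>
  Let \<open>C\<close> be the component of \<open>u\<close> among the non-neighbours of \<open>v\<close>, and \<open>S\<close> the set of vertices
  outside \<open>C\<close> adjacent to \<open>C\<close>. All of \<open>S\<close> is adjacent to \<open>v\<close>, and \<open>S\<close> is a clique: a shortest
  walk through \<open>C\<close> between non-adjacent members of \<open>S\<close> would close up to a chordless cycle at \<open>v\<close>.
  Induction on \<open>C \<union> S\<close> finds a simplicial vertex inside \<open>C\<close>, whose neighbours all lie in \<open>C \<union> S\<close>.
\<close>

lemma chordal_nonadjacent_simplicial:
  assumes "chordal E" "finite V" "v \<in> V" "u \<in> V" "u \<noteq> v" "{u, v} \<notin> E"
  shows "\<exists>s\<in>V. s \<noteq> v \<and> {s, v} \<notin> E \<and> simplicial E V s"
  using assms(2-)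
proof (induction V arbitrary: u v rule: finite_psubset_induct)
  case (psubset V)
  define D where "D = {w \<in> V. w \<noteq> v \<and> {w, v} \<notin> E}"
  define R where "R = {(a, b). a \<in> D \<and> b \<in> D \<and> a \<noteq> b \<and> {a, b} \<in> E}"
  define C where "C = R\<^sup>* `` {u}"
  define S where "S = {x \<in> V - C. \<exists>c\<in>C. {x, c} \<in> E}"
  have "u \<in> D" using psubset.prems by (simp add: D_def)
  have "u \<in> C" by (simp add: C_def)
  have CD: "C \<subseteq> D"
  proof
    fix c assume "c \<in> C"
    then have "(u, c) \<in> R\<^sup>*" by (simp add: C_def)
    then show "c \<in> D" by induction (use \<open>u \<in> D\<close> in \<open>auto simp: R_def\<close>)
  qed
  have closed: "d \<in> C" if "c \<in> C" "d \<in> D" "{c, d} \<in> E" for c d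
  proof (cases "c = d")
    case False
    then have "(c, d) \<in> R" using that CD by (auto simp: R_def)
    with that(1) show ?thesis unfolding C_def by (auto intro: rtrancl_into_rtrancl)
  qed (use that in simp)
  \<comment> \<open>A non-neighbour of \<open>v\<close> touching the component \<open>C\<close>
    would belong to \<open>C\<close>; and \<open>v\<close> itself touches nothing in
    \<open>C\<close>.\<close>
  have S_adj: "x \<noteq> v \<and> {x, v} \<in> E" if "x \<in> S" for x
  proof -
    from that obtain c where c: "x \<in> V" "x \<notin> C" "c \<in> C" "{x, c} \<in> E" unfolding S_def by blast
    then have "x \<notin> D" using closed[of c x] by (auto simp: insert_commute)
    moreover have "x \<noteq> v" using c CD by (auto simp: D_def insert_commute)
    ultimately show ?thesis using c by (auto simp: D_def)
  qed
  have S_clique: "{x, y} \<in> E" if xy: "x \<in> S" "y \<in> S" "x \<noteq> y" for x y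
  proof -
    define T where "T = {(a, b). a \<in> insert x (insert y C) \<and> b \<in> insert x (insert y C) \<and>
      a \<noteq> b \<and> {a, b} \<in> E}"
    have from_u: "(u, c) \<in> T\<^sup>*" if "c \<in> C" for c
    proof -
      have "(u, c) \<in> R\<^sup>*" using that by (simp add: C_def)
      then show ?thesis
      proof induction
        case (step a b)
        then have "a \<in> C" "b \<in> C" unfolding C_def by (auto intro: rtrancl_into_rtrancl)
        with step have "(a, b) \<in> T" by (auto simp: T_def R_def)
        with step show ?case by simp
      qed simp
    qed
    have "sym T" by (auto simp: sym_def T_def insert_commute)
    then have sym: "(a, b) \<in> T\<^sup>* \<Longrightarrow> (b, a) \<in> T\<^sup>*" for a b by (meson sym_rtrancl symD)
    have to: "(u, z) \<in> T\<^sup>*" if z: "z \<in> S" "z = x \<or> z = y" for z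
    proof -
      obtain c where c: "z \<notin> C" "c \<in> C" "{z, c} \<in> E" using z unfolding S_def by blast
      then have "(c, z) \<in> T" using z by (auto simp: T_def insert_commute)
      with from_u[OF c(2)] show ?thesis by simp
    qed
    have "(x, y) \<in> T\<^sup>*" using to[of x] to[of y] xy sym by (meson rtrancl_trans)
    moreover have "v \<notin> C" "\<And>c. c \<in> C \<Longrightarrow> {c, v} \<notin> E" using CD by (auto simp: D_def)
    ultimately show ?thesis
      using S_adj[OF xy(1)] S_adj[OF xy(2)] xy(3) unfolding T_def
      by (blast intro: chordal_neighbours_adjacent[OF \<open>chordal E\<close>])
  qed
  have lift: "\<exists>s\<in>V. s \<noteq> v \<and> {s, v} \<notin> E \<and> simplicial E V s"
    if s: "s \<in> C" "simplicial E (C \<union> S) s" for s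
  proof -
    have "a \<in> C \<union> S" if "a \<in> V" "{s, a} \<in> E" for a
      using that s unfolding S_def by (auto simp: insert_commute)
    then have "simplicial E V s" using s(2) unfolding simplicial_def by blast
    with s CD show ?thesis by (auto simp: D_def)
  qed
  have sub: "C \<union> S \<subset> V"
  proof -
    have "v \<notin> C \<union> S" using CD S_adj[of v] by (auto simp: D_def)
    moreover have "C \<union> S \<subseteq> V" using CD by (auto simp: D_def S_def)
    ultimately show ?thesis using \<open>v \<in> V\<close> by blast
  qed
  show ?case
  proof (cases "\<exists>s\<in>S. \<exists>c\<in>C. {c, s} \<notin> E")
    case True
    then obtain s c where sc: "s \<in> S" "c \<in> C" "{c, s} \<notin> E" by blast
    moreover have "c \<noteq> s" using sc by (auto simp: S_def)
    ultimately obtain t where "t \<in> C \<union> S" "t \<noteq> s" "{t, s} \<notin> E" "simplicial E (C \<union> S) t"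
      using psubset.IH[OF sub, of s c] by auto
    \<comment> \<open>As \<open>t\<close> is not adjacent to \<open>s\<close> and \<open>S\<close>
      is a clique, \<open>t\<close> lies in \<open>C\<close>.\<close>
    with S_clique sc lift show ?thesis by blast
  next
    case univ: False
    show ?thesis
    proof (cases "\<exists>c\<in>C. \<exists>d\<in>C. c \<noteq> d \<and> {c, d} \<notin> E")
      case True
      then obtain c d where cd: "c \<in> C" "d \<in> C" "c \<noteq> d" "{c, d} \<notin> E" by blast
      then obtain t where "t \<in> C \<union> S" "t \<noteq> d" "{t, d} \<notin> E" "simplicial E (C \<union> S) t"
        using psubset.IH[OF sub, of d c] by auto
      \<comment> \<open>Here every vertex of \<open>S\<close> is adjacent to all of
        \<open>C\<close>, so \<open>t\<close>, which misses \<open>d\<close>, lies in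
        \<open>C\<close>.\<close>
      with univ cd lift show ?thesis by (metis UnE insert_commute)
    next
      case False
      \<comment> \<open>What remains is the case where \<open>C \<union> S\<close> is a
        clique.\<close>
      with univ S_clique have "simplicial E (C \<union> S) u"
        unfolding simplicial_def by (metis UnE DiffE insert_commute)
      with lift \<open>u \<in> C\<close> show ?thesis by blast
    qed
  qed
qed

lemma chordal_simplicial_exists:
  assumes "chordal E" "finite V" "V \<noteq> {}"
  obtains s where "s \<in> V" "simplicial E V s"
proof (cases "\<exists>u\<in>V. \<exists>v\<in>V. u \<noteq> v \<and> {u, v} \<notin> E")
  case True
  with chordal_nonadjacent_simplicial[OF assms(1,2)] that show thesis by blast
next
  case False
  with assms(3) that show thesis unfolding simplicial_def by blast
qed

section \<open>Extension of antisymmetric functions\<close>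

text \<open>Here \<open>x\<close> is the row of a new vertex, and \<open>x k + g k l - x l\<close>
  its triangle sum with \<open>k\<close> and \<open>l\<close>. Triangles with one vertex in
  \<open>K\<close> force \<open>x w \<ge> m w - M\<close>; this least value also meets all other
  bounds.\<close>

lemma extend_potential_nonempty:
  fixes g :: "'a \<Rightarrow> 'a \<Rightarrow> real"
  assumes "finite W" "K \<subseteq> W" "K \<noteq> {}" "0 \<le> M"
    and anti: "\<And>i j. g j i = - g i j"
    and tri: "\<And>i j k. i \<in> W \<Longrightarrow> j \<in> W \<Longrightarrow> k \<in> W \<Longrightarrow> g i j + g j k + g k i \<le> M"
    and h: "\<And>k l. k \<in> K \<Longrightarrow> l \<in> K \<Longrightarrow> h k + g k l - h l \<le> M"
  obtains x where "\<And>k. k \<in> K \<Longrightarrow> x k = h k"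
    "\<And>k l. k \<in> W \<Longrightarrow> l \<in> W \<Longrightarrow> x k + g k l - x l \<le> M"
proof -
  define m where "m w = Max ((\<lambda>k. h k + g k w) ` K)" for w
  have "finite K" using assms(1,2) finite_subset by blast
  then have ge: "h k + g k w \<le> m w" if "k \<in> K" for k w
    unfolding m_def using that by auto
  have attained: "\<exists>k\<in>K. m w = h k + g k w" for w
    using Max_in[of "(\<lambda>k. h k + g k w) ` K"] \<open>finite K\<close> \<open>K \<noteq> {}\<close>
    unfolding m_def image_iff by blast
  define x where "x w = (if w \<in> K then h w else m w - M)" for w
  \<comment> \<open>For a maximizer \<open>k\<close> of \<open>m w\<close>, replacing
    \<open>m l\<close> by its lower bound \<open>h k + g k l\<close> leaves the triangle sum of
    \<open>k\<close>, \<open>w\<close>, \<open>l\<close>. Between two vertices outside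
    \<open>K\<close> the shifts by \<open>M\<close> cancel.\<close>
  have gap: "m w + g w l - m l \<le> M" if "w \<in> W" "l \<in> W" for w l
  proof -
    obtain k where "k \<in> K" "m w = h k + g k w" using attained by blast
    with ge[of k l] tri[of k w l] anti[of k l] that \<open>K \<subseteq> W\<close> show ?thesis by auto
  qed
  have "x k + g k l - x l \<le> M" if "k \<in> W" "l \<in> W" for k l
  proof (cases "k \<in> K"; cases "l \<in> K")
    assume "k \<in> K" "l \<in> K"
    then show ?thesis using h by (simp add: x_def)
  next
    assume "k \<in> K" "l \<notin> K"
    then show ?thesis using ge[of k l] by (simp add: x_def)
  next
    assume kl: "k \<notin> K" "l \<in> K"
    \<comment> \<open>The bound for \<open>h\<close> at \<open>j\<close>, \<open>l\<close> and the
      triangle \<open>j\<close>, \<open>k\<close>, \<open>l\<close> together cost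
      \<open>2 * M\<close>; the shift in \<open>x k\<close> pays for one \<open>M\<close>.\<close>
    obtain j where "j \<in> K" "m k = h j + g j k" using attained by blast
    then show ?thesis
      using kl h[of j l] tri[of j k l] anti[of j l] that \<open>K \<subseteq> W\<close> by (auto simp: x_def)
  next
    assume "k \<notin> K" "l \<notin> K"
    then show ?thesis using gap[OF that] by (simp add: x_def)
  qed
  moreover have "x k = h k" if "k \<in> K" for k using that by (simp add: x_def)
  ultimately show thesis using that by blast
qed

lemma extend_potential:
  fixes g :: "'a \<Rightarrow> 'a \<Rightarrow> real"
  assumes "finite W" "K \<subseteq> W" "0 \<le> M"
    and anti: "\<And>i j. g j i = - g i j"
    and tri: "\<And>i j k. i \<in> W \<Longrightarrow> j \<in> W \<Longrightarrow> k \<in> W \<Longrightarrow> g i j + g j k + g k i \<le> M"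
    and h: "\<And>k l. k \<in> K \<Longrightarrow> l \<in> K \<Longrightarrow> h k + g k l - h l \<le> M"
  obtains x where "\<And>k. k \<in> K \<Longrightarrow> x k = h k"
    "\<And>k l. k \<in> W \<Longrightarrow> l \<in> W \<Longrightarrow> x k + g k l - x l \<le> M"
proof (cases "K = {}")
  case False
  show thesis
    by (rule extend_potential_nonempty[OF assms(1,2) False assms(3) anti tri h]) (use that in auto)
next
  case True
  show thesis
  proof (cases "W = {}")
    case True
    with \<open>K = {}\<close> show thesis using that[of h] by simp
  next
    case False
    \<comment> \<open>With no prescribed values, the new vertex can copy the row of any
      \<open>b\<close>, so its triangle sums are those of \<open>b\<close>.\<close>
    then obtain b where b: "b \<in> W" by blast
    have "g b k + g k l - g b l \<le> M" if "k \<in> W" "l \<in> W" for k l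
      using tri[OF b that] anti[of b l] by simp
    with \<open>K = {}\<close> show thesis using that[of "g b"] by simp
  qed
qed

text \<open>Additive form of the theorem, by induction on \<open>V\<close>. The bound on
  \<open>g\<close> includes degenerate triples: antisymmetry makes their sums 0, which
  \<open>0 \<le> M\<close> covers.\<close>

lemma chordal_antisymmetric_extension:
  fixes f :: "'a \<Rightarrow> 'a \<Rightarrow> real"
  assumes "chordal E" "finite V" "0 \<le> M"
    and f_anti: "\<And>i j. i \<noteq> j \<Longrightarrow> {i, j} \<in> E \<Longrightarrow> f j i = - f i j"
    and f_tri: "\<And>i j k. i \<noteq> j \<Longrightarrow> j \<noteq> k \<Longrightarrow> k \<noteq> i \<Longrightarrow> {i, j} \<in> E \<Longrightarrow> {j, k} \<in> E \<Longrightarrow>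
      {k, i} \<in> E \<Longrightarrow> f i j + f j k + f k i \<le> M"
  shows "\<exists>g :: 'a \<Rightarrow> 'a \<Rightarrow> real. (\<forall>i j. g j i = - g i j) \<and>
    (\<forall>i\<in>V. \<forall>j\<in>V. i \<noteq> j \<and> {i, j} \<in> E \<longrightarrow> g i j = f i j) \<and>
    (\<forall>i\<in>V. \<forall>j\<in>V. \<forall>k\<in>V. g i j + g j k + g k i \<le> M)"
  using assms(2)
proof (induction V rule: finite_psubset_induct)
  case (psubset V)
  show ?case
  proof (cases "V = {}")
    case True
    then show ?thesis by (intro exI[of _ "\<lambda>_ _. 0"]) simp
  next
    case False
    then obtain s where s: "s \<in> V" "simplicial E V s"
      using chordal_simplicial_exists[OF assms(1) psubset.hyps] by blast
    define W where "W = V - {s}"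
    have "W \<subset> V" "finite W" using s psubset.hyps by (auto simp: W_def)
    obtain g where g: "\<forall>i j. g j i = - g i j"
      "\<forall>i\<in>W. \<forall>j\<in>W. i \<noteq> j \<and> {i, j} \<in> E \<longrightarrow> g i j = f i j"
      "\<forall>i\<in>W. \<forall>j\<in>W. \<forall>k\<in>W. g i j + g j k + g k i \<le> M"
      using psubset.IH[OF \<open>W \<subset> V\<close>] by (elim exE conjE)
    have anti: "g j i = - g i j" for i j
      using g(1) by (elim allE)
    have gf: "g i j = f i j" if "i \<in> W" "j \<in> W" "i \<noteq> j" "{i, j} \<in> E" for i j
      using g(2) that by blast
    have tri: "g i j + g j k + g k i \<le> M" if "i \<in> W" "j \<in> W" "k \<in> W" for i j k
      using g(3) that by blast
    have g_refl: "g i i = 0" for i using anti[of i i] by simp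
    define K where "K = {k \<in> W. {s, k} \<in> E}"
    have "K \<subseteq> W" by (auto simp: K_def)
    \<comment> \<open>Simpliciality of \<open>s\<close> makes \<open>s\<close>, \<open>k\<close>,
      \<open>l\<close> a triangle of \<open>E\<close> when \<open>k \<noteq> l\<close>, so the bound
      on \<open>f\<close> applies.\<close>
    have hK: "f s k + g k l - f s l \<le> M" if "k \<in> K" "l \<in> K" for k l
    proof (cases "k = l")
      case True
      then show ?thesis using \<open>0 \<le> M\<close> g_refl by simp
    next
      case False
      have kl: "k \<in> W" "l \<in> W" "k \<noteq> s" "l \<noteq> s" "{s, k} \<in> E" "{s, l} \<in> E"
        using that by (auto simp: K_def W_def)
      then have "{k, l} \<in> E" using s(2) False unfolding simplicial_def W_def by blast
      with kl False show ?thesis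
        using f_tri[of s k l] f_anti[of s l] gf[of k l] by (simp add: insert_commute)
    qed
    obtain x where xK: "\<And>k. k \<in> K \<Longrightarrow> x k = f s k"
      and x: "\<And>k l. k \<in> W \<Longrightarrow> l \<in> W \<Longrightarrow> x k + g k l - x l \<le> M"
      using extend_potential[where g = g and h = "f s",
          OF \<open>finite W\<close> \<open>K \<subseteq> W\<close> \<open>0 \<le> M\<close> anti tri hK]
      by blast
    define G where
      "G i j = (if i = s then if j = s then 0 else x j else if j = s then - x i else g i j)" for i j
    have "G j i = - G i j" for i j using anti[of j i] by (simp add: G_def)
    moreover have "G i j = f i j" if "i \<in> V" "j \<in> V" "i \<noteq> j" "{i, j} \<in> E" for i j
      using that xK[of j] xK[of i] gf[of i j] f_anti[of i j]
      by (auto simp: G_def K_def W_def insert_commute)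
    \<comment> \<open>The three instances of \<open>x\<close> match the three positions of
      \<open>s\<close> in the triple.\<close>
    moreover have "G i j + G j k + G k i \<le> M" if "i \<in> V" "j \<in> V" "k \<in> V" for i j k
      using that tri[of i j k] x[of j k] x[of i j] x[of k i] \<open>0 \<le> M\<close>
      by (auto simp: G_def W_def)
    ultimately show ?thesis by blast
  qed
qed

section \<open>Reciprocal completions\<close>

lemma three_cycle_productsI:
  assumes "i \<noteq> j" "j \<noteq> k" "k \<noteq> i" "B $ i $ j = Some x" "B $ j $ k = Some y" "B $ k $ i = Some z"
  shows "x * y * z \<in> three_cycle_products B"
  using assms unfolding three_cycle_products_def by blast

lemma three_cycle_product_le_MT:
  "p \<in> three_cycle_products B \<Longrightarrow> p \<le> MT B"
  using finite_three_cycle_products[of B] by (auto simp: MT_def)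

text \<open>A triangle product and its reciprocal, from the reversed triangle, cannot both be below
  1.\<close>

lemma one_le_MT:
  assumes "partial_reciprocal_matrix B"
  shows "1 \<le> MT B"
proof (cases "three_cycle_products B = {}")
  case True
  then show ?thesis by (simp add: MT_def)
next
  case False
  then obtain x y z i j k where ijk: "i \<noteq> j" "j \<noteq> k" "k \<noteq> i"
    and B: "B $ i $ j = Some x" "B $ j $ k = Some y" "B $ k $ i = Some z"
    unfolding three_cycle_products_def by blast
  have pos: "0 < x" "0 < y" "0 < z"
    and "B $ j $ i = Some (1 / x)" "B $ k $ j = Some (1 / y)" "B $ i $ k = Some (1 / z)"
    using B assms unfolding partial_reciprocal_matrix_def by blast+
  then have "1 / z * (1 / y) * (1 / x) \<in> three_cycle_products B"
    using ijk by (intro three_cycle_productsI[of i k j]) auto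
  then have "1 / (x * y * z) \<le> MT B"
    using three_cycle_product_le_MT by (fastforce simp: field_simps)
  moreover have "x * y * z \<le> MT B"
    by (intro three_cycle_product_le_MT three_cycle_productsI[OF ijk B])
  moreover have "1 \<le> x * y * z \<or> 1 \<le> 1 / (x * y * z)"
    using pos by (auto simp: le_divide_eq_1)
  ultimately show ?thesis by linarith
qed

text \<open>The condition \<open>1 \<le> c\<close> accounts for the default value of
  \<open>MT\<close> when there are no triangles.\<close>

lemma MT_le:
  assumes "1 \<le> c" "\<And>p. p \<in> three_cycle_products B \<Longrightarrow> p \<le> c"
  shows "MT B \<le> c"
  using assms finite_three_cycle_products[of B] by (auto simp: MT_def)

lemma spec_graph_edge_iff:
  assumes "partial_reciprocal_matrix B" "i \<noteq> j"
  shows "{i, j} \<in> spec_graph B \<longleftrightarrow> B $ i $ j \<noteq> None"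
  using assms unfolding spec_graph_def partial_reciprocal_matrix_def
  by (auto simp: doubleton_eq_iff)

theorem theorem5p4:
  fixes B :: "'n::finite partial_matrix"
  assumes "partial_reciprocal_matrix B"
    and "chordal (spec_graph B)"
  shows "\<exists>A :: real ^ 'n ^ 'n. reciprocal_completion B A \<and> MT (fully_specified A) = MT B"
proof -
  \<comment> \<open>Only values of \<open>f\<close> on edges matter, where the entry is
    specified.\<close>
  define f where "f i j = ln (the (B $ i $ j))" for i j
  note edge = spec_graph_edge_iff[OF assms(1)]
  have pos: "0 < x" "B $ j $ i = Some (1 / x)" if "B $ i $ j = Some x" for i j x
    using that assms(1) unfolding partial_reciprocal_matrix_def by blast+
  have MT1: "1 \<le> MT B" using one_le_MT[OF assms(1)] .
  have f_anti: "f j i = - f i j" if "i \<noteq> j" "{i, j} \<in> spec_graph B" for i j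
    using that edge pos[of i j] by (auto simp: f_def ln_div)
  have f_tri: "f i j + f j k + f k i \<le> ln (MT B)"
    if ijk: "i \<noteq> j" "j \<noteq> k" "k \<noteq> i"
      and E: "{i, j} \<in> spec_graph B" "{j, k} \<in> spec_graph B" "{k, i} \<in> spec_graph B" for i j k
  proof -
    obtain x y z where B: "B $ i $ j = Some x" "B $ j $ k = Some y" "B $ k $ i = Some z"
      using E ijk edge by auto
    then have "x * y * z \<le> MT B"
      by (intro three_cycle_product_le_MT three_cycle_productsI[OF ijk])
    moreover have "0 < x" "0 < y" "0 < z" using B pos by blast+
    moreover from this have "ln (x * y * z) = ln x + ln y + ln z"
      by (simp add: ln_mult)
    ultimately have "ln x + ln y + ln z \<le> ln (MT B)"
      by (metis ln_mono mult_pos_pos)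
    with B show ?thesis by (simp add: f_def)
  qed
  have "0 \<le> ln (MT B)" using MT1 by simp
  then have "\<exists>g :: 'n \<Rightarrow> 'n \<Rightarrow> real. (\<forall>i j. g j i = - g i j) \<and>
    (\<forall>i\<in>UNIV. \<forall>j\<in>UNIV. i \<noteq> j \<and> {i, j} \<in> spec_graph B \<longrightarrow> g i j = f i j) \<and>
    (\<forall>i\<in>UNIV. \<forall>j\<in>UNIV. \<forall>k\<in>UNIV. g i j + g j k + g k i \<le> ln (MT B))"
    by (rule chordal_antisymmetric_extension[OF assms(2) finite _ f_anti f_tri])
  then obtain g where g: "\<forall>i j. g j i = - g i j"
    "\<forall>i\<in>UNIV. \<forall>j\<in>UNIV. i \<noteq> j \<and> {i, j} \<in> spec_graph B \<longrightarrow> g i j = f i j"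
    "\<forall>i\<in>UNIV. \<forall>j\<in>UNIV. \<forall>k\<in>UNIV. g i j + g j k + g k i \<le> ln (MT B)"
    by (elim exE conjE)
  have anti: "g j i = - g i j" for i j
    using g(1) by (elim allE)
  have gf: "g i j = f i j" if "i \<noteq> j" "{i, j} \<in> spec_graph B" for i j
    using g(2) that by blast
  have tri: "g i j + g j k + g k i \<le> ln (MT B)" for i j k
    using g(3) by blast
  define A :: "real ^ 'n ^ 'n" where "A = (\<chi> i j. exp (g i j))"
  have A: "A $ i $ j = exp (g i j)" for i j by (simp add: A_def)
  have recip: "reciprocal_matrix A"
    unfolding reciprocal_matrix_def A by (metis anti exp_gt_zero exp_minus inverse_eq_divide)
  have diag: "A $ i $ i = 1" for i using anti[of i i] by (simp add: A)
  have agree: "A $ i $ j = x" if "B $ i $ j = Some x" for i j x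
  proof (cases "i = j")
    case True
    then have "x = 1" using that assms(1) unfolding partial_reciprocal_matrix_def by auto
    with True diag show ?thesis by simp
  next
    case False
    with that have "g i j = ln x" using gf edge by (simp add: f_def)
    with pos(1)[OF that] show ?thesis by (simp add: A)
  qed
  have spec: "fully_specified A $ i $ j = Some (A $ i $ j)" for i j
    by (simp add: fully_specified_def)
  have "0 < x \<and> fully_specified A $ j $ i = Some (1 / x)"
    if "fully_specified A $ i $ j = Some x" for i j x
  proof -
    have "x = A $ i $ j" using that by (simp add: spec)
    moreover have "0 < A $ i $ j" "A $ j $ i = 1 / A $ i $ j"
      using recip unfolding reciprocal_matrix_def by blast+
    ultimately show ?thesis unfolding spec by blast
  qed
  moreover have "fully_specified A $ i $ i = Some 1" for i by (simp add: spec diag)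
  ultimately have "partial_reciprocal_matrix (fully_specified A)"
    unfolding partial_reciprocal_matrix_def by blast
  \<comment> \<open>This gives \<open>MT B \<le> MT (fully_specified A)\<close> even if
    \<open>B\<close> has no specified triangle and \<open>MT B\<close> is 1 by default.\<close>
  then have "1 \<le> MT (fully_specified A)" by (rule one_le_MT)
  moreover have "p \<le> MT (fully_specified A)" if "p \<in> three_cycle_products B" for p
  proof -
    from that obtain x y z i j k where p: "p = x * y * z" and ijk: "i \<noteq> j" "j \<noteq> k" "k \<noteq> i"
      and B: "B $ i $ j = Some x" "B $ j $ k = Some y" "B $ k $ i = Some z"
      unfolding three_cycle_products_def by blast
    show ?thesis
      unfolding p using B[THEN agree]
      by (intro three_cycle_product_le_MT three_cycle_productsI[OF ijk])
        (simp_all add: spec)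
  qed
  moreover have "p \<le> MT B" if "p \<in> three_cycle_products (fully_specified A)" for p
  proof -
    from that obtain i j k where "p = A $ i $ j * A $ j $ k * A $ k $ i"
      unfolding three_cycle_products_def fully_specified_def by auto
    then have "p = exp (g i j + g j k + g k i)" by (simp add: A exp_add)
    also have "\<dots> \<le> exp (ln (MT B))" using tri by simp
    also have "\<dots> = MT B" using MT1 by simp
    finally show ?thesis .
  qed
  ultimately have "MT (fully_specified A) = MT B"
    using MT1 by (intro antisym MT_le)
  with recip agree show ?thesis unfolding reciprocal_completion_def by blast
qed

end
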